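(* Let $I\subseteq\mathbb{R}$ be an interval, and for each $x\in I$ let $Z^x, Z_1^x, Z_2^x,\dots$ be $I$-valued random variables such that for each $f\in C_b(I)$ the functions $x\mapsto E f(Z^x)$ and $x\mapsto E f(Z_n^x)$ ($n\ge 1$) are continuous on $I$. Let $L_n, L: C_b(I)\to C_b(I)$ be the positive linear operators $L_n(f(t);x):=E f(Z_n^x)$, $L(f(t);x):=E f(Z^x)$. Suppose that for each $s\in\mathbb{R}$ and $x\in I$, $$\lim_{n\to\infty} L_n(e^{ist};x)=L(e^{ist};x),$$ and that for each $x\in I$ the function $s\mapsto L(e^{ist};x)$ is continuous on $\mathbb{R}$. Then $$\lim_{n\to\infty} L_n(f(t);x)=L(f(t);x)$$ for all $f\in C_b(I)$ and $x\in I$.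
   Context: $C_b(I)$ is the space of all real-valued continuous bounded functions on $I$, $E$ denotes mathematical expectation, and $i$ is the imaginary unit. The notation $L_n(f(t);x)$ means the value at $x$ of $L_n$ applied to the function $t\mapsto f(t)$. For $s\in\mathbb{R}$ one defines $L_n(e^{ist};x):=L_n(\cos(st);x)+i\,L_n(\sin(st);x)$, and similarly for $L(e^{ist};x)$. *)

theory Defs
  imports "HOL-Probability.Probability"
begin

text \<open>Functions on \<open>I\<close> are represented by total functions on the reals; the values outside
  \<open>I\<close> are irrelevant.\<close>

definition Cb :: "real set \<Rightarrow> (real \<Rightarrow> real) set" where
  "Cb I = {f. continuous_on I f \<and> bounded (f ` I)}"

text \<open>\<open>expect_op M Z f x\<close> is $E f(Z^x)$. The random variables for different \<open>x\<close> may live on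
  different probability spaces.\<close>

definition expect_op ::
    "(real \<Rightarrow> 'a measure) \<Rightarrow> (real \<Rightarrow> 'a \<Rightarrow> real) \<Rightarrow> (real \<Rightarrow> real) \<Rightarrow> real \<Rightarrow> real" where
  "expect_op M Z f x = prob_space.expectation (M x) (\<lambda>\<omega>. f (Z x \<omega>))"

text \<open>\<open>op_cexp L s x\<close> is $L(e^{ist};x)$, where the real operator \<open>L\<close> acts separately on the
  real and imaginary parts.\<close>

definition op_cexp :: "((real \<Rightarrow> real) \<Rightarrow> real \<Rightarrow> real) \<Rightarrow> real \<Rightarrow> real \<Rightarrow> complex" where
  "op_cexp L s x =
     complex_of_real (L (\<lambda>t. cos (s * t)) x) + \<i> * complex_of_real (L (\<lambda>t. sin (s * t)) x)"

end

theory Submission imports Defs begin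

text \<open>For fixed \<open>x\<close>, the number $L_n(e^{ist};x)$ is the value at \<open>s\<close> of the characteristic function of
  $Z_n^x$, so the hypothesis is pointwise convergence of characteristic functions to the
  characteristic function of $Z^x$, and Levy's continuity theorem gives convergence in
  distribution. What remains is the passage to a test function that is bounded and continuous only
  on \<open>I\<close>: if \<open>I\<close> is not closed, such a function need not extend continuously to the real line.
  Skorohod's representation theorem replaces the variables by variables with the same distributions
  that converge pointwise. Almost surely all of these and their limit lie in \<open>I\<close>, where
  continuity relative to \<open>I\<close> suffices to carry the convergence through \<open>f\<close>; dominated
  convergence finishes the proof (\<open>weak_conv_imp_integral_continuous_on_support\<close>).\<close>

text \<open>Discontinuities of \<open>f\<close> at points of \<open>A\<close> are allowed, even where \<open>M\<close> has an atom, as long as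
  they are seen only from outside \<open>A\<close>. The continuous mapping theorem, which requires the
  discontinuity set to be \<open>M\<close>-null, does not cover this case: take for \<open>f\<close> the indicator of a
  half-open interval \<open>A\<close> and for \<open>M\<close> a measure with an atom at its closed end.\<close>

lemma weak_conv_imp_integral_continuous_on_support:
  fixes f :: "real \<Rightarrow> 'a :: {banach, second_countable_topology}"
  assumes \<mu>: "\<And>n. real_distribution (\<mu> n)" and M: "real_distribution M"
    and conv: "weak_conv_m \<mu> M"
    and supp_\<mu>: "\<And>n. AE t in \<mu> n. t \<in> A" and supp_M: "AE t in M. t \<in> A"
    and f_cont: "continuous_on A f" and f_bdd: "\<And>t. norm (f t) \<le> B"
    and [measurable]: "f \<in> borel_measurable borel"
  shows "(\<lambda>n. integral\<^sup>L (\<mu> n) f) \<longlonglongrightarrow> integral\<^sup>L M f"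
proof -
  obtain \<Omega> :: "real measure" and Y_seq Y where
    ps: "prob_space \<Omega>" and
    [measurable]: "\<And>n. Y_seq n \<in> borel_measurable \<Omega>" "Y \<in> borel_measurable \<Omega>" and
    distr_Y_seq: "\<And>n. distr \<Omega> borel (Y_seq n) = \<mu> n" and
    distr_Y: "distr \<Omega> borel Y = M" and
    lim_Y: "\<And>\<omega>. \<omega> \<in> space \<Omega> \<Longrightarrow> (\<lambda>n. Y_seq n \<omega>) \<longlonglongrightarrow> Y \<omega>"
    using Skorohod[OF \<mu> M conv] by force
  interpret prob_space \<Omega> by fact
  have "AE \<omega> in \<Omega>. Y_seq n \<omega> \<in> A" for n
    using supp_\<mu>[of n] by (intro AE_distrD[where f = "Y_seq n" and M' = borel]) (simp_all only: distr_Y_seq, simp)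
  then have Y_seq_in: "AE \<omega> in \<Omega>. \<forall>n. Y_seq n \<omega> \<in> A"
    by (simp add: AE_all_countable)
  have Y_in: "AE \<omega> in \<Omega>. Y \<omega> \<in> A"
    using supp_M by (intro AE_distrD[where f = Y and M' = borel]) (simp_all only: distr_Y, simp)
  have "AE \<omega> in \<Omega>. (\<lambda>n. f (Y_seq n \<omega>)) \<longlonglongrightarrow> f (Y \<omega>)"
    using Y_seq_in Y_in AE_space
  proof eventually_elim
    case (elim \<omega>)
    then show ?case
      by (intro continuous_on_tendsto_compose[OF f_cont lim_Y]) auto
  qed
  then have "(\<lambda>n. expectation (\<lambda>\<omega>. f (Y_seq n \<omega>))) \<longlonglongrightarrow> expectation (\<lambda>\<omega>. f (Y \<omega>))"
    by (intro integral_dominated_convergence[where w = "\<lambda>_. B"]) (auto simp: f_bdd)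
  then show ?thesis
    by (simp add: integral_distr distr_Y_seq [symmetric] distr_Y [symmetric])
qed

lemma op_cexp_expect_op_eq_char:
  assumes "prob_space (M x)" and [measurable]: "Z x \<in> borel_measurable (M x)"
  shows "op_cexp (expect_op M Z) s x = char (distr (M x) borel (Z x)) s"
proof -
  interpret prob_space "M x" by fact
  have int: "integrable (M x) (\<lambda>\<omega>. iexp (s * Z x \<omega>))"
    by (rule integrable_const_bound[where B = 1]) auto
  have "char (distr (M x) borel (Z x)) s = expectation (\<lambda>\<omega>. iexp (s * Z x \<omega>))"
    unfolding char_def by (rule integral_distr) auto
  also have "\<dots> = op_cexp (expect_op M Z) s x"
    unfolding op_cexp_def expect_op_def using int
    by (intro complex_eqI) (simp_all add: Re_exp Im_exp flip: integral_Re integral_Im)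
  finally show ?thesis by simp
qed

text \<open>The values of \<open>f\<close> outside \<open>I\<close> are arbitrary, so \<open>f\<close> need not be Borel measurable on the real
  line; cutting it off outside \<open>I\<close> repairs this and leaves the expectation unchanged, because
  \<open>Z x\<close> takes its values in \<open>I\<close>.\<close>

lemma expect_op_eq_integral_distr:
  assumes I: "I \<in> sets borel" and f: "continuous_on I f"
    and Z: "Z x \<in> M x \<rightarrow>\<^sub>M restrict_space borel I"
  shows "expect_op M Z f x = (LINT t|distr (M x) borel (Z x). indicator I t *\<^sub>R f t)"
proof -
  have [measurable]: "Z x \<in> borel_measurable (M x)" and Z_in: "\<And>\<omega>. \<omega> \<in> space (M x) \<Longrightarrow> Z x \<omega> \<in> I"
    using Z by (auto simp: measurable_restrict_space2_iff)
  have "(LINT t|distr (M x) borel (Z x). indicator I t *\<^sub>R f t)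
      = (LINT \<omega>|M x. indicator I (Z x \<omega>) *\<^sub>R f (Z x \<omega>))"
    by (intro integral_distr borel_measurable_continuous_on_indicator I f) simp
  also have "\<dots> = expect_op M Z f x"
    unfolding expect_op_def by (intro Bochner_Integration.integral_cong) (auto simp: Z_in)
  finally show ?thesis by simp
qed

theorem theorem2p1:
  fixes I :: "real set"
    and M :: "real \<Rightarrow> 'a measure" and Z :: "real \<Rightarrow> 'a \<Rightarrow> real"
    and M_seq :: "nat \<Rightarrow> real \<Rightarrow> 'b measure" and Z_seq :: "nat \<Rightarrow> real \<Rightarrow> 'b \<Rightarrow> real"
    and L :: "(real \<Rightarrow> real) \<Rightarrow> real \<Rightarrow> real"
    and L_seq :: "nat \<Rightarrow> (real \<Rightarrow> real) \<Rightarrow> real \<Rightarrow> real"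
  defines "L \<equiv> expect_op M Z"
    and "L_seq \<equiv> \<lambda>n. expect_op (M_seq n) (Z_seq n)"
  assumes interval: "is_interval I"
    and prob: "\<And>x. x \<in> I \<Longrightarrow> prob_space (M x)"
    and rv: "\<And>x. x \<in> I \<Longrightarrow> prob_space.random_variable (M x) (restrict_space borel I) (Z x)"
    and prob_seq: "\<And>n x. n \<ge> 1 \<Longrightarrow> x \<in> I \<Longrightarrow> prob_space (M_seq n x)"
    and rv_seq: "\<And>n x. n \<ge> 1 \<Longrightarrow> x \<in> I \<Longrightarrow>
      prob_space.random_variable (M_seq n x) (restrict_space borel I) (Z_seq n x)"
    and cont: "\<And>f. f \<in> Cb I \<Longrightarrow> continuous_on I (L f)"
    and cont_seq: "\<And>n f. n \<ge> 1 \<Longrightarrow> f \<in> Cb I \<Longrightarrow> continuous_on I (L_seq n f)"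
    and lim: "\<And>s x. x \<in> I \<Longrightarrow> (\<lambda>n. op_cexp (L_seq n) s x) \<longlonglongrightarrow> op_cexp L s x"
    and cont_s: "\<And>x. x \<in> I \<Longrightarrow> continuous_on UNIV (\<lambda>s. op_cexp L s x)"
  shows "\<forall>f\<in>Cb I. \<forall>x\<in>I. (\<lambda>n. L_seq n f x) \<longlonglongrightarrow> L f x"
proof (intro ballI)
  fix f x assume f: "f \<in> Cb I" and x: "x \<in> I"
  have I: "I \<in> sets borel"
    using interval by (simp add: is_interval_convex real_interval_borel_measurable)
  \<comment> \<open>The variables $Z_n^x$ are given only for \<open>n \<ge> 1\<close>, hence the shift of the index.\<close>
  define \<mu> where "\<mu> n = distr (M_seq (Suc n) x) borel (Z_seq (Suc n) x)" for n
  define \<nu> where "\<nu> = distr (M x) borel (Z x)"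
  define g where "g t = indicator I t *\<^sub>R f t" for t
  note rv = rv[OF x] and prob = prob[OF x]
  have rv_seq: "Z_seq (Suc n) x \<in> M_seq (Suc n) x \<rightarrow>\<^sub>M restrict_space borel I"
    and prob_seq: "prob_space (M_seq (Suc n) x)" for n
    using rv_seq[OF _ x] prob_seq[OF _ x] by simp_all
  have Z_meas [measurable]: "Z x \<in> borel_measurable (M x)"
    and Z_seq_meas [measurable]: "\<And>n. Z_seq (Suc n) x \<in> borel_measurable (M_seq (Suc n) x)"
    using rv rv_seq by (simp_all add: measurable_restrict_space2_iff)
  have \<mu>: "real_distribution (\<mu> n)" for n
    unfolding \<mu>_def using prob_seq Z_seq_meas by (rule prob_space.real_distribution_distr)
  have \<nu>: "real_distribution \<nu>"
    unfolding \<nu>_def using prob Z_meas by (rule prob_space.real_distribution_distr)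
  have "(\<lambda>n. char (\<mu> n) s) \<longlonglongrightarrow> char \<nu> s" for s
    using LIMSEQ_Suc[OF lim[OF x, of s]]
    by (simp add: L_def L_seq_def \<mu>_def \<nu>_def op_cexp_expect_op_eq_char prob prob_seq)
  then have conv: "weak_conv_m \<mu> \<nu>"
    by (rule levy_continuity[OF \<mu> \<nu>])
  have supp: "AE t in \<mu> n. t \<in> I" "AE t in \<nu>. t \<in> I" for n
    using rv rv_seq I unfolding \<mu>_def \<nu>_def
    by (auto simp: AE_distr_iff measurable_restrict_space2_iff)
  from f have f_cont: "continuous_on I f" by (simp add: Cb_def)
  obtain B where "\<And>t. t \<in> I \<Longrightarrow> norm (f t) \<le> B" and "B > 0"
    using f by (force simp: Cb_def bounded_pos)
  then have g_bdd: "norm (g t) \<le> B" for t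
    by (auto simp: g_def indicator_def)
  have g_cont: "continuous_on I g"
    using f_cont by (rule continuous_on_eq) (simp add: g_def)
  have g_meas: "g \<in> borel_measurable borel"
    unfolding g_def by (rule borel_measurable_continuous_on_indicator[OF I f_cont])
  have "(\<lambda>n. integral\<^sup>L (\<mu> n) g) \<longlonglongrightarrow> integral\<^sup>L \<nu> g"
    by (rule weak_conv_imp_integral_continuous_on_support
        [OF \<mu> \<nu> conv supp g_cont g_bdd g_meas])
  then have "(\<lambda>n. L_seq (Suc n) f x) \<longlonglongrightarrow> L f x"
    by (simp add: L_def L_seq_def \<mu>_def \<nu>_def g_def[abs_def]
        expect_op_eq_integral_distr[where I = I, OF I f_cont] rv rv_seq)
  then show "(\<lambda>n. L_seq n f x) \<longlonglongrightarrow> L f x"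
    by (rule LIMSEQ_imp_Suc)
qed

end
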